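(* For each positive integer $r$ there is a constant $c_r$ such that if $n \ge k \ge 2$ are integers, then $$h(n, k, W_{2r+1}) \le c_r \frac{n^2}{k^{2 - 1/(r+1)}}.$$
   Context: All graphs are finite, undirected and simple. A graph is $H$-free if it does not contain $H$ as a (not necessarily induced) subgraph. For a graph $G$ and a positive integer $k$, $h(G,k)$ is the minimum number of edges that can be deleted from $G$ so that the remaining graph is $k$-colorable. For a graph $H$ and positive integers $n,k$, $h(n,k,H)$ is the maximum of $h(G,k)$ over all $H$-free graphs $G$ on $n$ vertices. The wheel $W_\ell$ is the graph on $\ell+1$ vertices consisting of an $\ell$-cycle and an additional vertex adjacent to all vertices of the $\ell$-cycle. *)

theory Defs
  imports Complex_Main
begin

text \<open>A graph is a pair of a vertex set and a set of edges; in a finite simple graph every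
  edge is a two-element set of vertices.\<close>

type_synonym 'a graph = "'a set \<times> 'a set set"

abbreviation verts :: "'a graph \<Rightarrow> 'a set" where
  "verts \<equiv> fst"

abbreviation edges :: "'a graph \<Rightarrow> 'a set set" where
  "edges \<equiv> snd"

definition simple_graph :: "'a graph \<Rightarrow> bool" where
  "simple_graph G \<longleftrightarrow> finite (verts G) \<and> (\<forall>e\<in>edges G. e \<subseteq> verts G \<and> card e = 2)"

text \<open>Containment of a (not necessarily induced) copy of \<open>H\<close> in \<open>G\<close>.\<close>

definition contains_subgraph :: "'a graph \<Rightarrow> 'b graph \<Rightarrow> bool" where
  "contains_subgraph G H \<longleftrightarrow>
     (\<exists>f. inj_on f (verts H) \<and> f ` verts H \<subseteq> verts G \<and> (\<forall>e\<in>edges H. f ` e \<in> edges G))"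

definition is_free :: "'b graph \<Rightarrow> 'a graph \<Rightarrow> bool" where
  "is_free H G \<longleftrightarrow> \<not> contains_subgraph G H"

definition colorable :: "nat \<Rightarrow> 'a graph \<Rightarrow> bool" where
  "colorable k G \<longleftrightarrow>
     (\<exists>c. c ` verts G \<subseteq> {..<k} \<and> (\<forall>u v. {u, v} \<in> edges G \<longrightarrow> c u \<noteq> c v))"

definition h_graph :: "'a graph \<Rightarrow> nat \<Rightarrow> nat" where
  "h_graph G k = Min {card F | F. F \<subseteq> edges G \<and> colorable k (verts G, edges G - F)}"

text \<open>Every finite graph is isomorphic to one whose vertices are natural numbers, so the
  maximum may be taken over those.\<close>

definition h_free :: "nat \<Rightarrow> nat \<Rightarrow> 'b graph \<Rightarrow> nat" where
  "h_free n k H =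
     Max {h_graph G k | G :: nat graph. simple_graph G \<and> card (verts G) = n \<and> is_free H G}"

text \<open>The rim is the cycle \<open>0, \<dots>, l - 1\<close> and the hub is \<open>l\<close>; this is the wheel only for
  \<open>l \<ge> 3\<close>.\<close>

definition wheel :: "nat \<Rightarrow> nat graph" where
  "wheel l = ({..l}, {{i, (i + 1) mod l} | i. i < l} \<union> {{i, l} | i. i < l})"

text \<open>The sets in the definitions of \<open>h_graph\<close> and \<open>h_free\<close> are finite and nonempty, so that
  \<open>Min\<close> and \<open>Max\<close> are the actual minimum and maximum.\<close>

lemma simple_graph_finite_edges:
  assumes "simple_graph G"
  shows "finite (edges G)" and "card (edges G) \<le> 2 ^ card (verts G)"
proof -
  have sub: "edges G \<subseteq> Pow (verts G)" and fin: "finite (verts G)"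
    using assms by (auto simp: simple_graph_def)
  show "finite (edges G)"
    using finite_subset[OF sub] fin by simp
  show "card (edges G) \<le> 2 ^ card (verts G)"
    using card_mono[OF _ sub] fin by (simp add: card_Pow)
qed

lemma h_graph_set:
  assumes "simple_graph G" and "k \<ge> 1"
  defines "S \<equiv> {card F | F. F \<subseteq> edges G \<and> colorable k (verts G, edges G - F)}"
  shows "finite S" and "card (edges G) \<in> S"
proof -
  have "S \<subseteq> card ` Pow (edges G)" by (auto simp: S_def)
  then show "finite S"
    using simple_graph_finite_edges(1)[OF assms(1)] by (auto intro: finite_subset[of S "card ` Pow (edges G)"])
  have "colorable k (verts G, edges G - edges G)"
    using assms(2) by (auto simp: colorable_def intro!: exI[of _ "\<lambda>_. 0"])
  then show "card (edges G) \<in> S"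
    by (auto simp: S_def)
qed

lemma h_free_set:
  fixes n k :: nat and H :: "'b graph"
  assumes "k \<ge> 1" and "edges H \<noteq> {}"
  defines "S \<equiv> {h_graph G k | G :: nat graph. simple_graph G \<and> card (verts G) = n \<and> is_free H G}"
  shows "finite S" and "S \<noteq> {}"
proof -
  have "x \<le> 2 ^ n" if "x \<in> S" for x
  proof -
    from that obtain G :: "nat graph" where G: "x = h_graph G k" "simple_graph G" "card (verts G) = n"
      by (auto simp: S_def)
    have "x \<le> card (edges G)"
      unfolding G(1) h_graph_def using h_graph_set[OF G(2) assms(1)] by (intro Min_le) auto
    also have "\<dots> \<le> 2 ^ n"
      using simple_graph_finite_edges(2)[OF G(2)] G(3) by simp
    finally show ?thesis .
  qed
  then show "finite S"
    by (intro finite_subset[of S "{..2 ^ n}"]) auto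
  have "simple_graph ({..<n}, {})" and "is_free H ({..<n}, {})"
    using assms(2) by (auto simp: simple_graph_def is_free_def contains_subgraph_def)
  then have "h_graph ({..<n}, {}) k \<in> S"
    unfolding S_def by (intro CollectI exI[of _ "({..<n}, {})"]) auto
  then show "S \<noteq> {}"
    by blast
qed

lemma simple_graph_wheel:
  assumes "l \<ge> 3"
  shows "simple_graph (wheel l)"
proof -
  have rim: "(i + 1) mod l \<noteq> i" "(i + 1) mod l < l" if "i < l" for i
    using that assms by (cases "i + 1 = l"; simp)+
  have "e \<subseteq> {..l} \<and> card e = 2" if "e \<in> edges (wheel l)" for e
  proof -
    from that consider i where "i < l" "e = {i, (i + 1) mod l}" | i where "i < l" "e = {i, l}"
      unfolding wheel_def by auto
    then show ?thesis
    proof cases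
      case 1
      then show ?thesis
        using rim[of i] by (simp del: One_nat_def add: less_imp_le)
    next
      case 2
      then show ?thesis by simp
    qed
  qed
  then show ?thesis
    by (simp add: simple_graph_def wheel_def)
qed

end

theory Submission
  imports Defs
begin

text \<open>A \<open>C\<^bsub>2 r + 1\<^esub>\<close>-free graph on \<open>m\<close> vertices can be \<open>t\<close>-coloured with \<open>O(m\<^sup>2 / t ^ (r + 1))\<close>
  monochromatic edges. Indeed, the breadth-first layers at distance at most \<open>r\<close> from a vertex are
  \<open>2 r\<close>-colourable, and if the degree of that vertex is more than \<open>m / K ^ r\<close>, one of these layers grows by
  a factor of at most \<open>K\<close> in the next step. So the graph contains an independent set that is only
  \<open>O(K)\<close> times smaller than a set around it holding all its neighbours. Removing such sets
  repeatedly leaves a graph of maximum degree at most \<open>m / K ^ r\<close>, which a random colouring handles.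

  In a \<open>W\<^bsub>2 r + 1\<^esub>\<close>-free graph on \<open>n\<close> vertices, peel off subsets of about \<open>D = n x / k\<close>
  vertices of neighbourhoods, where \<open>x ^ (r + 1) = k\<close>, and colour each of them with its own \<open>x / 2\<close>
  colours as above. At most \<open>k / x\<close> sets are peeled off, and the remaining graph has maximum degree
  at most \<open>D\<close>, so it is coloured at random with the other \<open>k / 2\<close> colours. The value of \<open>D\<close> balances the
  two costs.\<close>

section \<open>Colourings from bounded chains, and averaging\<close>

text \<open>Elements of \<open>A\<close> without an \<open>R\<close>-predecessor in \<open>A\<close>
  get the top colour. Any chain in the rest can be prolonged at its front, so there the length bound
  drops by one.\<close>

lemma chain_colouring:
  fixes R :: "'a \<Rightarrow> 'a \<Rightarrow> bool"
  assumes "\<And>xs. set xs \<subseteq> A \<Longrightarrow> successively R xs \<Longrightarrow> length xs \<le> m"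
  shows "\<exists>c::'a \<Rightarrow> nat. (\<forall>x\<in>A. c x < m) \<and> (\<forall>x\<in>A. \<forall>y\<in>A. R x y \<longrightarrow> c x \<noteq> c y)"
  using assms
proof (induction m arbitrary: A)
  case 0
  have "A = {}"
  proof (rule equals0I)
    fix x assume "x \<in> A"
    then show False using 0[of "[x]"] by simp
  qed
  then show ?case by simp
next
  case (Suc m)
  define M where "M = {x \<in> A. \<forall>y\<in>A. \<not> R y x}"
  have "length xs \<le> m" if xs: "set xs \<subseteq> A - M" "successively R xs" for xs
  proof (cases xs)
    case (Cons y ys)
    then obtain z where "z \<in> A" "R z y"
      using xs(1) unfolding M_def by auto
    then have "length (z # xs) \<le> Suc m"
      using Suc.prems[of "z # xs"] xs Cons by auto
    then show ?thesis by simp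
  qed simp
  from Suc.IH[OF this] obtain c :: "'a \<Rightarrow> nat" where c: "\<forall>x\<in>A - M. c x < m"
    "\<forall>x\<in>A - M. \<forall>y\<in>A - M. R x y \<longrightarrow> c x \<noteq> c y" by blast
  let ?c = "\<lambda>x. if x \<in> M then m else c x"
  have 1: "?c x < Suc m" if "x \<in> A" for x
    using c(1) that by (auto simp: less_Suc_eq)
  have 2: "?c x \<noteq> ?c y" if "x \<in> A" "y \<in> A" "R x y" for x y
  proof -
    have "y \<notin> M" using that unfolding M_def by auto
    then show ?thesis using c that by (cases "x \<in> M") auto
  qed
  show ?case using 1 2 by (intro exI[of _ ?c] conjI ballI impI) blast+
qed

lemma exists_large_colour_class:
  fixes c :: "'a \<Rightarrow> nat"
  assumes "finite A" "\<And>x. x \<in> A \<Longrightarrow> c x < m"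
  shows "\<exists>j. card A \<le> m * card {x \<in> A. c x = j}"
proof (rule ccontr)
  assume "\<not> ?thesis"
  then have less: "m * card {x \<in> A. c x = j} < card A" for j
    by (meson not_le)
  have "m > 0"
    using assms(2) less[of 0] by (cases "A = {}") (auto intro: gr0I)
  have "A = (\<Union>j<m. {x \<in> A. c x = j})"
    using assms(2) by auto
  then have "card A \<le> (\<Sum>j<m. card {x \<in> A. c x = j})"
    by (metis card_UN_le finite_lessThan)
  then have "m * card A \<le> (\<Sum>j<m. m * card {x \<in> A. c x = j})"
    by (simp flip: sum_distrib_left)
  also have "\<dots> < (\<Sum>j<m. card A)"
    using \<open>m > 0\<close> less by (intro sum_strict_mono) auto
  finally show False by simp
qed

lemma exists_small_colour_class:
  fixes c :: "'a \<Rightarrow> nat"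
  assumes "finite A" "m > 0"
  shows "\<exists>j<m. m * card {x \<in> A. c x = j} \<le> card A"
proof (rule ccontr)
  assume "\<not> ?thesis"
  then have less: "card A < m * card {x \<in> A. c x = j}" if "j < m" for j
    using that by (meson not_le)
  have "(\<Sum>j<m. card {x \<in> A. c x = j}) = card (\<Union>j<m. {x \<in> A. c x = j})"
    using assms by (intro card_UN_disjoint[symmetric]) auto
  also have "\<dots> \<le> card A"
    using assms by (intro card_mono) auto
  finally have "(\<Sum>j<m. m * card {x \<in> A. c x = j}) \<le> (\<Sum>j<m. card A)"
    by (simp flip: sum_distrib_left)
  moreover have "(\<Sum>j<m. card A) < (\<Sum>j<m. m * card {x \<in> A. c x = j})"
    using assms less by (intro sum_strict_mono) auto
  ultimately show False by simp
qed

section \<open>Colourings with few monochromatic pairs\<close>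

locale irreflexive_graph =
  fixes E :: "'a \<Rightarrow> 'a \<Rightarrow> bool"
  assumes sym: "E x y \<Longrightarrow> E y x"
    and irrefl: "\<not> E x x"
begin

definition nbrs :: "'a set \<Rightarrow> 'a \<Rightarrow> 'a set" where
  "nbrs A x = {y \<in> A. E x y}"

definition indep :: "'a set \<Rightarrow> bool" where
  "indep I \<longleftrightarrow> (\<forall>x\<in>I. \<forall>y\<in>I. \<not> E x y)"

definition cycle_free :: "nat \<Rightarrow> 'a set \<Rightarrow> bool" where
  "cycle_free l A \<longleftrightarrow>
    \<not> (\<exists>f. inj_on f {..<l} \<and> f ` {..<l} \<subseteq> A \<and> (\<forall>i<l. E (f i) (f ((i + 1) mod l))))"

text \<open>The pairs are ordered, so each monochromatic edge counts twice and degree sums bound the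
  cost directly.\<close>

definition mono_pairs :: "'a set \<Rightarrow> ('a \<Rightarrow> nat) \<Rightarrow> ('a \<times> 'a) set" where
  "mono_pairs A c = {(x, y). x \<in> A \<and> y \<in> A \<and> E x y \<and> c x = c y}"

definition colours :: "'a set \<Rightarrow> nat \<Rightarrow> real \<Rightarrow> bool" where
  "colours A k B \<longleftrightarrow> (\<exists>c. (\<forall>x\<in>A. c x < k) \<and> real (card (mono_pairs A c)) \<le> B)"

lemma cycle_free_subset: "cycle_free l A \<Longrightarrow> B \<subseteq> A \<Longrightarrow> cycle_free l B"
  unfolding cycle_free_def by (meson subset_trans)

lemma finite_nbrs: "finite A \<Longrightarrow> finite (nbrs A x)"
  by (simp add: nbrs_def)

lemma finite_mono_pairs: "finite A \<Longrightarrow> finite (mono_pairs A c)"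
  by (rule finite_subset[of _ "A \<times> A"]) (auto simp: mono_pairs_def)

lemma card_mono_pairs_le:
  assumes "finite A"
  shows "card (mono_pairs A c) \<le> (\<Sum>x\<in>A. card (nbrs A x))"
proof -
  have "card (mono_pairs A c) \<le> card (SIGMA x:A. nbrs A x)"
    using assms finite_nbrs by (intro card_mono) (auto simp: mono_pairs_def nbrs_def)
  then show ?thesis using assms by (simp add: finite_nbrs)
qed

lemma card_mono_pairs_insert:
  assumes "finite A" "x \<notin> A"
  shows "card (mono_pairs (insert x A) c)
    = card (mono_pairs A c) + 2 * card {y \<in> nbrs A x. c y = c x}"
proof -
  define S where "S = {y \<in> nbrs A x. c y = c x}"
  have S: "finite S" "x \<notin> S"
    using assms by (auto simp: S_def nbrs_def)
  have "mono_pairs (insert x A) c = mono_pairs A c \<union> ({x} \<times> S \<union> S \<times> {x})"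
    using sym irrefl by (auto simp: mono_pairs_def S_def nbrs_def)
  also have "card \<dots> = card (mono_pairs A c) + card ({x} \<times> S \<union> S \<times> {x})"
    using S assms by (intro card_Un_disjoint finite_mono_pairs) (auto simp: mono_pairs_def)
  also have "card ({x} \<times> S \<union> S \<times> {x}) = card ({x} \<times> S) + card (S \<times> {x})"
    using S by (intro card_Un_disjoint) auto
  finally show ?thesis
    by (simp add: S_def card_cartesian_product)
qed

lemma colours_mono:
  assumes "colours A k B" "k \<le> k'" "B \<le> B'"
  shows "colours A k' B'"
  using assms unfolding colours_def by (meson less_le_trans order_trans)

lemma colours_empty: "0 \<le> B \<Longrightarrow> colours {} k B"
  by (auto simp: colours_def mono_pairs_def)

lemma colours_indep:
  assumes "indep I" "0 \<le> B"
  shows "colours I 1 B"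
proof -
  have "mono_pairs I (\<lambda>_. 0) = {}"
    using assms by (auto simp: mono_pairs_def indep_def)
  then show ?thesis
    unfolding colours_def using assms by (intro exI[of _ "\<lambda>_. 0"]) simp
qed

text \<open>Shifting the second palette by \<open>k\<close> makes the palettes disjoint, so no edge
  between the parts becomes monochromatic. Vertices in both sets keep their first colour.\<close>

lemma colours_union:
  assumes "finite A" "finite A'" "colours A k B" "colours A' k' B'"
  shows "colours (A \<union> A') (k + k') (B + B')"
proof -
  obtain c c' where c: "\<forall>x\<in>A. c x < k" "real (card (mono_pairs A c)) \<le> B"
    and c': "\<forall>x\<in>A'. c' x < k'" "real (card (mono_pairs A' c')) \<le> B'"
    using assms(3,4) unfolding colours_def by blast
  define d where "d x = (if x \<in> A then c x else k + c' x)" for x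
  have "mono_pairs (A \<union> A') d \<subseteq> mono_pairs A c \<union> mono_pairs A' c'"
    using c(1) c'(1) by (fastforce simp: mono_pairs_def d_def split: if_splits)
  then have "card (mono_pairs (A \<union> A') d) \<le> card (mono_pairs A c \<union> mono_pairs A' c')"
    using assms finite_mono_pairs by (intro card_mono) auto
  also have "\<dots> \<le> card (mono_pairs A c) + card (mono_pairs A' c')"
    by (rule card_Un_le)
  finally have "real (card (mono_pairs (A \<union> A') d)) \<le> B + B'"
    using c(2) c'(2) by linarith
  moreover have "\<forall>x\<in>A \<union> A'. d x < k + k'"
    using c(1) c'(1) by (auto simp: d_def trans_less_add1)
  ultimately show ?thesis
    unfolding colours_def by blast
qed

lemma colours_split:
  assumes "finite A" "H \<subseteq> A" "colours (A - H) k B" "colours H k' B'"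
  shows "colours A (k + k') (B + B')"
proof -
  have "colours ((A - H) \<union> H) (k + k') (B + B')"
    using assms by (intro colours_union) (auto intro: finite_subset)
  moreover have "(A - H) \<union> H = A" using assms by auto
  ultimately show ?thesis by simp
qed

text \<open>Colouring the vertices one at a time with the colour that is rarest among the
  neighbours coloured so far does as well as a uniformly random colouring.\<close>

lemma colours_greedy:
  assumes "finite A" "k > 0"
  shows "colours A k (card (mono_pairs A (\<lambda>_. 0)) / k)"
  using assms(1)
proof (induction A rule: finite_induct)
  case empty
  then show ?case by (intro colours_empty) simp
next
  case (insert x A)
  then obtain c where c: "\<forall>y\<in>A. c y < k"
    "real (card (mono_pairs A c)) \<le> card (mono_pairs A (\<lambda>_. 0)) / k"
    unfolding colours_def by blast
  obtain j where j: "j < k" "k * card {y \<in> nbrs A x. c y = j} \<le> card (nbrs A x)"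
    using exists_small_colour_class[OF finite_nbrs[OF insert.hyps(1)] assms(2)] by blast
  define d where "d = c(x := j)"
  have "mono_pairs A d = mono_pairs A c" "{y \<in> nbrs A x. d y = d x} = {y \<in> nbrs A x. c y = j}"
    using insert.hyps by (auto simp: mono_pairs_def d_def nbrs_def split: if_splits)
  then have "card (mono_pairs (insert x A) d)
      = card (mono_pairs A c) + 2 * card {y \<in> nbrs A x. c y = j}"
    using card_mono_pairs_insert[OF insert.hyps, of d] by simp
  moreover have "real (card {y \<in> nbrs A x. c y = j}) \<le> card (nbrs A x) / k"
    using j(2) assms(2) by (simp add: field_simps flip: of_nat_mult)
  ultimately have "real (card (mono_pairs (insert x A) d))
      \<le> card (mono_pairs A (\<lambda>_. 0)) / k + 2 * (card (nbrs A x) / k)"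
    using c(2) by simp
  also have "\<dots> = card (mono_pairs (insert x A) (\<lambda>_. 0)) / k"
    using card_mono_pairs_insert[OF insert.hyps, of "\<lambda>_. 0"] by (simp add: add_divide_distrib)
  finally show ?case
    unfolding colours_def using c(1) j(1) insert.hyps by (intro exI[of _ d]) (auto simp: d_def)
qed

lemma colours_degree:
  fixes d :: real
  assumes "finite A" "k > 0" "\<And>x. x \<in> A \<Longrightarrow> real (card (nbrs A x)) \<le> d"
  shows "colours A k (real (card A) * d / k)"
proof -
  have "real (card (mono_pairs A (\<lambda>_. 0))) \<le> (\<Sum>x\<in>A. real (card (nbrs A x)))"
    using card_mono_pairs_le[OF assms(1), of "\<lambda>_. 0"] by (metis of_nat_le_iff of_nat_sum)
  also have "\<dots> \<le> card A * d"
    using sum_bounded_above[of A "\<lambda>x. real (card (nbrs A x))" d] assms(3) by simp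
  finally show ?thesis
    by (intro colours_mono[OF colours_greedy[OF assms(1,2)]]) (auto intro: divide_right_mono)
qed

text \<open>The crude bound for the cases in which the target cost is at least
  \<open>m\<^sup>2\<close>.\<close>

lemma colours_trivial:
  assumes "finite A" "k > 0" "real (card A) \<le> m"
  shows "colours A k (m\<^sup>2)"
proof -
  have "real (card (nbrs A x)) \<le> card A" for x
    using assms(1) by (simp add: card_mono nbrs_def)
  then have "colours A k (real (card A) * card A / k)"
    using assms by (intro colours_degree) auto
  moreover have "real (card A) * card A / k \<le> real (card A) * card A / 1"
    using assms(2) by (intro divide_left_mono) auto
  moreover have "real (card A) * card A \<le> m * m"
    using assms(3) by (intro mult_mono) auto
  ultimately show ?thesis
    by (elim colours_mono) (auto simp: power2_eq_square)
qed

end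

section \<open>Layers of a rooted tree and the cycles they force\<close>

text \<open>A tree inside the graph with root \<open>v\<close>, parent map \<open>p\<close> and
  depth classes \<open>L j\<close>. The numbering \<open>idx\<close> serves to order each layer by
  root paths.\<close>

locale rooted_layers = irreflexive_graph E for E :: "'a \<Rightarrow> 'a \<Rightarrow> bool" +
  fixes A :: "'a set" and L :: "nat \<Rightarrow> 'a set" and p :: "'a \<Rightarrow> 'a" and v :: 'a
    and idx :: "'a \<Rightarrow> nat" and N :: nat
  assumes L_subset: "L j \<subseteq> A"
    and L_disjoint: "i \<noteq> j \<Longrightarrow> L i \<inter> L j = {}"
    and L_0: "L 0 = {v}"
    and parent: "x \<in> L (Suc j) \<Longrightarrow> p x \<in> L j \<and> E x (p x)"
    and inj_idx: "inj_on idx A"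
    and idx_less: "x \<in> A \<Longrightarrow> idx x < N"
begin

lemma ancestor_in_layer: "x \<in> L (j + h) \<Longrightarrow> (p ^^ h) x \<in> L j"
proof (induction h arbitrary: x)
  case (Suc h)
  then show ?case
    using parent[of x "j + h"] by (simp add: funpow_Suc_right del: funpow.simps)
qed simp

lemma ancestor_in_layer': "x \<in> L i \<Longrightarrow> h \<le> i \<Longrightarrow> (p ^^ h) x \<in> L (i - h)"
  using ancestor_in_layer[of x "i - h" h] by simp

lemma ancestor_edge:
  assumes "x \<in> L i" "h < i"
  shows "E ((p ^^ h) x) ((p ^^ Suc h) x)"
  using parent[of "(p ^^ h) x" "i - Suc h"] ancestor_in_layer'[OF assms(1), of h] assms(2)
  by (simp add: Suc_diff_Suc)

lemma layer_unique: "x \<in> L i \<Longrightarrow> x \<in> L j \<Longrightarrow> i = j"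
  using L_disjoint by blast

text \<open>The cycle follows the path \<open>x 0, ..., x d\<close>, climbs \<open>H\<close> parents
  from \<open>x d\<close> to the common ancestor and descends to \<open>x 0\<close>. Vertices on
  different levels differ; on equal levels, path vertices differ by injectivity and the two branches
  by \<open>apart\<close>.\<close>

lemma cycle_from_branches:
  assumes "1 \<le> H" "H \<le> i"
    and path: "\<And>j. j < d \<Longrightarrow> E (x j) (x (Suc j))" "inj_on x {..d}" "\<And>j. j \<le> d \<Longrightarrow> x j \<in> L i"
    and meet: "(p ^^ H) (x d) = (p ^^ H) (x 0)"
    and apart: "\<And>s. s < H \<Longrightarrow> (p ^^ s) (x d) \<noteq> (p ^^ s) (x 0)"
  shows "\<not> cycle_free (d + 2 * H) A"
proof -
  define l where "l = d + 2 * H"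
  define f where "f m = (if m \<le> d then x m else if m \<le> d + H then (p ^^ (m - d)) (x d)
    else (p ^^ (l - m)) (x 0))" for m
  define lev where "lev m = (if m \<le> d then i else if m \<le> d + H then i - (m - d)
    else i - (l - m))" for m
  \<comment> \<open>The three descriptions overlap at \<open>m = d\<close> and, by
    \<open>meet\<close>, at \<open>m = d + H\<close>. So every edge except the closing one lies
    within one of them.\<close>
  have f_path: "f m = x m" if "m \<le> d" for m
    using that by (simp add: f_def)
  have f_up: "f m = (p ^^ (m - d)) (x d)" if "d \<le> m" "m \<le> d + H" for m
    using that by (cases "m = d") (auto simp: f_def)
  have f_down: "f m = (p ^^ (l - m)) (x 0)" if "d + H \<le> m" "m < l" for m
  proof (cases "m = d + H")
    case True
    moreover have "l - m = H" using True by (simp add: l_def)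
    ultimately show ?thesis using meet assms(1) by (simp add: f_def)
  qed (use that in \<open>auto simp: f_def\<close>)
  have lev: "f m \<in> L (lev m)" if "m < l" for m
  proof -
    consider "m \<le> d" | "d < m" "m \<le> d + H" | "d + H < m" by linarith
    then show ?thesis
    proof cases
      case 1
      then show ?thesis using path(3) by (simp add: f_def lev_def)
    next
      case 2
      then show ?thesis
        using ancestor_in_layer'[OF path(3)[of d], of "m - d"] assms(2) by (simp add: f_def lev_def)
    next
      case 3
      then have "l - m \<le> i" using assms(2) by (simp add: l_def)
      then show ?thesis
        using 3 ancestor_in_layer'[OF path(3)[of 0], of "l - m"] by (simp add: f_def lev_def)
    qed
  qed
  have "inj_on f {..<l}"
  proof (rule linorder_inj_onI')
    fix a b assume ab: "a \<in> {..<l}" "b \<in> {..<l}" "a < b"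
    show "f a \<noteq> f b"
    proof
      assume eq: "f a = f b"
      then have lev_eq: "lev a = lev b"
        using lev[of a] lev[of b] ab layer_unique by auto
      consider "b \<le> d" | "a \<le> d" "d < b" | "d < a" "a \<le> d + H" "d + H < b"
        | "d < a" "b \<le> d + H" | "d + H < a"
        using ab by linarith
      then show False
      proof cases
        case 1
        then show False using eq path(2) ab by (auto simp: f_def inj_on_def)
      next
        case 2
        then show False using lev_eq ab assms(1,2) by (auto simp: lev_def l_def split: if_splits)
      next
        case 3
        then have s: "a - d = l - b"
          using lev_eq ab assms(2) by (simp add: lev_def l_def split: if_splits)
        then have "(p ^^ (l - b)) (x d) = (p ^^ (l - b)) (x 0)"
          using eq 3 f_up[of a] f_down[of b] ab by simp
        moreover have "l - b < H" using 3 ab by (auto simp: l_def)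
        ultimately show False using apart by blast
      next
        case 4
        then show False using lev_eq ab assms(2) by (simp add: lev_def)
      next
        case 5
        then show False using lev_eq ab assms(2) by (simp add: lev_def l_def)
      qed
    qed
  qed
  moreover have "f ` {..<l} \<subseteq> A"
    using lev L_subset by blast
  moreover have "E (f m) (f ((m + 1) mod l))" if "m < l" for m
  proof -
    consider "m < d" | "d \<le> m" "m < d + H" | "d + H \<le> m" "Suc m < l" | "d + H \<le> m" "Suc m = l"
      using \<open>m < l\<close> by linarith
    then show ?thesis
    proof cases
      case 1
      moreover from 1 have "Suc m mod l = Suc m" using assms(1) by (simp add: l_def)
      ultimately show ?thesis using path(1) by (simp add: f_path)
    next
      case 2
      then have "Suc m mod l = Suc m" using assms(1) by (simp add: l_def)
      then show ?thesis
        using 2 ancestor_edge[OF path(3)[of d], of "m - d"] assms(2) by (simp add: f_up Suc_diff_le)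
    next
      case 3
      have "l - m = Suc (l - Suc m)" using 3 by simp
      moreover have "l - Suc m < i" using 3 assms(1,2) by (auto simp: l_def)
      ultimately show ?thesis
        using 3 sym[OF ancestor_edge[OF path(3)[of 0], of "l - Suc m"]]
        by (simp add: f_down)
    next
      case 4
      have "l - m = Suc 0" using 4 by simp
      then show ?thesis
        using 4 sym[OF ancestor_edge[OF path(3)[of 0], of 0]] assms(1,2) \<open>m < l\<close>
        by (simp add: f_down f_path)
    qed
  qed
  ultimately show ?thesis
    unfolding cycle_free_def l_def by blast
qed

text \<open>The base-\<open>N\<close> digits of \<open>key j x\<close> are the indices of the vertices on the path from the root to
  \<open>x\<close>. Dividing by \<open>N ^ h\<close> passes to the ancestor \<open>h\<close> levels up, and is monotone.\<close>

primrec key :: "nat \<Rightarrow> 'a \<Rightarrow> nat" where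
  "key 0 x = 0"
| "key (Suc j) x = key j (p x) * N + idx x"

lemma key_div: "x \<in> L (j + h) \<Longrightarrow> key (j + h) x div N ^ h = key j ((p ^^ h) x)"
proof (induction h arbitrary: x)
  case (Suc h)
  have "idx x < N" using Suc.prems L_subset idx_less by blast
  then have "key (j + Suc h) x div N ^ Suc h = key (j + h) (p x) div N ^ h"
    by (simp add: div_mult2_eq)
  also have "\<dots> = key j ((p ^^ h) (p x))"
    using Suc parent[of x "j + h"] by simp
  finally show ?case by (simp add: funpow_Suc_right del: funpow.simps)
qed simp

text \<open>The last digit is the index of the vertex itself, and \<open>idx\<close> is injective;
  layer 0 consists of the root.\<close>

lemma key_inj: "x \<in> L j \<Longrightarrow> y \<in> L j \<Longrightarrow> key j x = key j y \<Longrightarrow> x = y"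
proof (cases j)
  case (Suc i)
  assume xy: "x \<in> L j" "y \<in> L j" "key j x = key j y"
  then have A: "x \<in> A" "y \<in> A" using L_subset by blast+
  have "key j x mod N = idx x" "key j y mod N = idx y"
    using A idx_less Suc by simp_all
  then show ?thesis using xy A inj_idx by (metis inj_onD)
qed (use L_0 in auto)

text \<open>Turns common ancestors into arithmetic, so that monotonicity of \<open>div\<close>
  replaces an argument about ordered subtrees.\<close>

lemma ancestor_eq_iff_key:
  assumes "x \<in> L i" "y \<in> L i" "h \<le> i"
  shows "(p ^^ h) x = (p ^^ h) y \<longleftrightarrow> key i x div N ^ h = key i y div N ^ h"
  using key_div[of x "i - h" h] key_div[of y "i - h" h] assms
    key_inj[of "(p ^^ h) x" "i - h" "(p ^^ h) y"]
    ancestor_in_layer'[OF assms(1,3)] ancestor_in_layer'[OF assms(2,3)] by auto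

text \<open>An increasing path on \<open>2 r + 1\<close> vertices of a layer would give a cycle of length
  \<open>2 r + 1\<close>: let \<open>H\<close> be the largest distance to the nearest common ancestor of two consecutive
  path vertices. Any stretch of the path that contains such a pair has ends with
  nearest common ancestor exactly \<open>H\<close> levels up, so take one of length \<open>2 r + 1 - 2 H\<close>.\<close>

lemma layer_colouring:
  assumes cf: "cycle_free (2 * r + 1) A" and i: "i \<le> r" and "r > 0"
  shows "\<exists>c. (\<forall>x\<in>L i. c x < 2 * r) \<and> (\<forall>x\<in>L i. \<forall>y\<in>L i. E x y \<longrightarrow> c x \<noteq> (c y :: nat))"
proof -
  \<comment> \<open>Orienting the edges by their keys makes every \<open>R\<close>-chain an
    increasing path.\<close>
  define R where "R x y \<longleftrightarrow> E x y \<and> key i x < key i y" for x y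
  have "length xs \<le> 2 * r" if xs: "set xs \<subseteq> L i" "successively R xs" for xs
  proof (rule ccontr)
    assume "\<not> ?thesis"
    then have len: "length xs \<ge> 2 * r + 1" by simp
    define n where "n = length xs - 1"
    have n: "length xs = Suc n" "2 * r \<le> n" using len by (auto simp: n_def)
    define \<kappa> where "\<kappa> j = key i (xs ! j)" for j
    have in_L: "xs ! j \<in> L i" if "j \<le> n" for j
      using that n xs(1) by (auto simp: subset_iff)
    have step: "R (xs ! j) (xs ! Suc j)" if "j < n" for j
      using that n xs(2) by (simp add: successively_conv_nth)
    have \<kappa>_less: "\<kappa> a < \<kappa> b" if "a < b" "b \<le> n" for a b
      using that
    proof (induction b)
      case (Suc b)
      then show ?case using step[of b] by (auto simp: less_Suc_eq R_def \<kappa>_def)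
    qed simp
    have \<kappa>_le: "\<kappa> a \<le> \<kappa> b" if "a \<le> b" "b \<le> n" for a b
      using that \<kappa>_less[of a b] by (cases "a = b") auto
    \<comment> \<open>By \<open>ancestor_eq_iff_key\<close>, the path vertices \<open>j\<close> and
      \<open>j + 1\<close> have different ancestors \<open>h\<close> levels up.\<close>
    define sep where "sep h j \<longleftrightarrow> \<kappa> j div N ^ h \<noteq> \<kappa> (Suc j) div N ^ h" for h j
    \<comment> \<open>At height \<open>i\<close> every ancestor is the root, so the least height
      \<open>H\<close> exists and is at most \<open>i\<close>.\<close>
    have "\<not> sep i j" if "j < n" for j
      using ancestor_eq_iff_key[of "xs ! j" i "xs ! Suc j" i] in_L[of j] in_L[of "Suc j"] that
        ancestor_in_layer'[of "xs ! j" i i] ancestor_in_layer'[of "xs ! Suc j" i i] L_0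
      by (simp add: sep_def \<kappa>_def)
    then have ex: "\<exists>h. \<forall>j<n. \<not> sep h j" by blast
    define H where "H = (LEAST h. \<forall>j<n. \<not> sep h j)"
    have H: "\<not> sep H j" if "j < n" for j
      using LeastI_ex[OF ex] that unfolding H_def by blast
    have "H \<le> i"
      using \<open>\<And>j. j < n \<Longrightarrow> \<not> sep i j\<close> unfolding H_def by (blast intro: Least_le)
    have "sep 0 0"
      using \<kappa>_less[of 0 1] n \<open>r > 0\<close> by (simp add: sep_def)
    then have "H \<noteq> 0"
      using H[of 0] n \<open>r > 0\<close> by (intro notI) simp
    have "\<not> (\<forall>j<n. \<not> sep (H - 1) j)"
      using not_less_Least[of "H - 1" "\<lambda>h. \<forall>j<n. \<not> sep h j"] \<open>H \<noteq> 0\<close> by (simp add: H_def)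
    then obtain q where q: "q < n" "sep (H - 1) q" by blast
    \<comment> \<open>\<open>d >= 1\<close> because \<open>H <= i <= r\<close>, and
      \<open>d <= n\<close> because \<open>H >= 1\<close> and \<open>2 * r <= n\<close>.\<close>
    define d where "d = 2 * r + 1 - 2 * H"
    have d: "1 \<le> d" "d \<le> n" "d + 2 * H = 2 * r + 1"
      using \<open>H \<le> i\<close> \<open>H \<noteq> 0\<close> i n by (auto simp: d_def)
    \<comment> \<open>The window from \<open>a\<close> to \<open>a + d\<close> contains
      \<open>q\<close> and \<open>q + 1\<close> and is shifted left if it would overrun the end of
      the path.\<close>
    define a where "a = min q (n - d)"
    have a: "a \<le> q" "Suc q \<le> a + d" "a + d \<le> n"
      using q(1) d by (auto simp: a_def)
    have same: "\<kappa> (a + j) div N ^ H = \<kappa> a div N ^ H" if "j \<le> d" for j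
      using that
    proof (induction j)
      case (Suc j)
      then show ?case using H[of "a + j"] a(3) by (simp add: sep_def)
    qed simp
    \<comment> \<open>If the ends agreed at height \<open>s\<close>, monotonicity would squeeze
      \<open>q\<close> and \<open>q + 1\<close> together at height \<open>s\<close>, hence also at
      height \<open>H - 1\<close>, against the choice of \<open>q\<close>.\<close>
    have different: "\<kappa> a div N ^ s \<noteq> \<kappa> (a + d) div N ^ s" if "s < H" for s
    proof
      assume eq: "\<kappa> a div N ^ s = \<kappa> (a + d) div N ^ s"
      have "\<kappa> a \<le> \<kappa> q" "\<kappa> q \<le> \<kappa> (Suc q)" "\<kappa> (Suc q) \<le> \<kappa> (a + d)"
        using a q \<kappa>_le by auto
      then have "\<kappa> a div N ^ s \<le> \<kappa> q div N ^ s" "\<kappa> q div N ^ s \<le> \<kappa> (Suc q) div N ^ s"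
        "\<kappa> (Suc q) div N ^ s \<le> \<kappa> (a + d) div N ^ s"
        by (auto intro: div_le_mono)
      then have "\<kappa> q div N ^ s = \<kappa> (Suc q) div N ^ s" using eq by linarith
      then have "\<kappa> q div N ^ s div N ^ (H - 1 - s) = \<kappa> (Suc q) div N ^ s div N ^ (H - 1 - s)"
        by simp
      moreover have "N ^ s * N ^ (H - 1 - s) = N ^ (H - 1)"
        using that by (simp flip: power_add)
      ultimately show False using q(2) by (simp add: sep_def flip: div_mult2_eq)
    qed
    have "\<not> cycle_free (d + 2 * H) A"
    proof (rule cycle_from_branches[where x = "\<lambda>j. xs ! (a + j)" and i = i])
      show "1 \<le> H" using \<open>H \<noteq> 0\<close> by simp
      show "H \<le> i" by fact
      show "E (xs ! (a + j)) (xs ! (a + Suc j))" if "j < d" for j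
        using step[of "a + j"] that a(3) by (simp add: R_def)
      show "inj_on (\<lambda>j. xs ! (a + j)) {..d}"
      proof (rule linorder_inj_onI')
        fix j k assume "j \<in> {..d}" "k \<in> {..d}" "j < k"
        then show "xs ! (a + j) \<noteq> xs ! (a + k)"
          using \<kappa>_less[of "a + j" "a + k"] a(3) by (auto simp: \<kappa>_def)
      qed
      show "xs ! (a + j) \<in> L i" if "j \<le> d" for j
        using in_L that a(3) by simp
      show "(p ^^ H) (xs ! (a + d)) = (p ^^ H) (xs ! (a + 0))"
        using same[of d] ancestor_eq_iff_key[of "xs ! (a + d)" i "xs ! a" H] in_L a(3) \<open>H \<le> i\<close>
        by (simp add: \<kappa>_def)
      show "(p ^^ s) (xs ! (a + d)) \<noteq> (p ^^ s) (xs ! (a + 0))" if "s < H" for s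
        using different[OF that] ancestor_eq_iff_key[of "xs ! (a + d)" i "xs ! a" s] in_L a(3)
          \<open>H \<le> i\<close> that by (simp add: \<kappa>_def)
    qed
    then show False using cf d(3) by simp
  qed
  from chain_colouring[OF this] obtain c :: "'a \<Rightarrow> nat" where c: "\<forall>x\<in>L i. c x < 2 * r"
    "\<forall>x\<in>L i. \<forall>y\<in>L i. R x y \<longrightarrow> c x \<noteq> c y" by blast
  \<comment> \<open>Keys are injective on the layer, so each edge is an \<open>R\<close>-step in one
    of its directions.\<close>
  have "c x \<noteq> c y" if "x \<in> L i" "y \<in> L i" "E x y" for x y
  proof -
    have "key i x \<noteq> key i y" using key_inj that irrefl by metis
    then show ?thesis using c(2) that sym unfolding R_def by (metis linorder_less_linear)
  qed
  then show ?thesis using c(1) by blast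
qed

end

section \<open>Breadth-first layers and large independent sets\<close>

context irreflexive_graph
begin

primrec ball :: "'a set \<Rightarrow> 'a \<Rightarrow> nat \<Rightarrow> 'a set" where
  "ball S v 0 = {v}"
| "ball S v (Suc i) = ball S v i \<union> {x \<in> S. \<exists>y\<in>ball S v i. E x y}"

primrec layer :: "'a set \<Rightarrow> 'a \<Rightarrow> nat \<Rightarrow> 'a set" where
  "layer S v 0 = {v}"
| "layer S v (Suc i) = ball S v (Suc i) - ball S v i"

lemma ball_subset: "v \<in> S \<Longrightarrow> ball S v i \<subseteq> S"
  by (induction i) auto

lemma ball_mono: "i \<le> j \<Longrightarrow> ball S v i \<subseteq> ball S v j"
  by (rule lift_Suc_mono_le[of "ball S v"]) auto

lemma layer_subset_ball: "layer S v i \<subseteq> ball S v i"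
  by (cases i) auto

lemma layer_disjoint_aux: "i < j \<Longrightarrow> layer S v i \<inter> layer S v j = {}"
  using ball_mono[of i "j - 1" S v] layer_subset_ball[of S v i] by (cases j) auto

lemma layer_disjoint: "i \<noteq> j \<Longrightarrow> layer S v i \<inter> layer S v j = {}"
  using layer_disjoint_aux by (metis Int_commute linorder_neqE_nat)

lemma exists_parent:
  assumes "x \<in> layer S v (Suc j)"
  shows "\<exists>y\<in>layer S v j. E x y"
proof -
  obtain y where y: "y \<in> ball S v j" "E x y" "x \<in> S" "x \<notin> ball S v j"
    using assms by auto
  have "y \<in> layer S v j"
  proof (cases j)
    case (Suc i)
    then have "y \<notin> ball S v i" using y by auto
    then show ?thesis using y Suc by simp
  qed (use y in simp)
  then show ?thesis using y by blast
qed

lemma layer_large_indep: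
  assumes "finite S" "v \<in> S" "cycle_free (2 * r + 1) S" "0 < r" "i \<le> r"
  shows "\<exists>I\<subseteq>layer S v i. indep I \<and> card (layer S v i) \<le> 2 * r * card I"
proof -
  obtain idx :: "'a \<Rightarrow> nat" and N where idx: "idx ` S = {i. i < N}" "inj_on idx S"
    using finite_imp_inj_to_nat_seg[OF assms(1)] by metis
  \<comment> \<open>One map has to serve all layers; as layers are disjoint, the \<open>j\<close>
    hidden in the choice is determined by \<open>x\<close>.\<close>
  define par where "par x = (SOME y. E x y \<and> (\<exists>j. x \<in> layer S v (Suc j) \<and> y \<in> layer S v j))" for x
  have par: "par x \<in> layer S v j \<and> E x (par x)" if "x \<in> layer S v (Suc j)" for x j
  proof -
    have "\<exists>y. E x y \<and> (\<exists>j. x \<in> layer S v (Suc j) \<and> y \<in> layer S v j)"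
      using exists_parent[OF that] that by blast
    then have "E x (par x) \<and> (\<exists>j. x \<in> layer S v (Suc j) \<and> par x \<in> layer S v j)"
      unfolding par_def by (rule someI_ex)
    then obtain j' where j': "E x (par x)" "x \<in> layer S v (Suc j')" "par x \<in> layer S v j'"
      by blast
    then have "j' = j" using layer_disjoint[of "Suc j'" "Suc j" S v] that by blast
    then show ?thesis using j' by simp
  qed
  interpret rooted_layers E S "layer S v" par v idx N
  proof
    show "layer S v j \<subseteq> S" for j
      using ball_subset[OF assms(2)] layer_subset_ball by blast
    show "idx x < N" if "x \<in> S" for x using idx(1) that by blast
    show "layer S v i \<inter> layer S v j = {}" if "i \<noteq> j" for i j using layer_disjoint that .
    show "layer S v 0 = {v}" by simp
    show "par x \<in> layer S v j \<and> E x (par x)" if "x \<in> layer S v (Suc j)" for x j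
      using par that .
    show "inj_on idx S" by fact
  qed
  obtain c where c: "\<forall>x\<in>layer S v i. c x < 2 * r"
    "\<forall>x\<in>layer S v i. \<forall>y\<in>layer S v i. E x y \<longrightarrow> c x \<noteq> (c y :: nat)"
    using layer_colouring[OF assms(3,5,4)] by blast
  have "finite (layer S v i)"
    using L_subset assms(1) by (rule finite_subset)
  then obtain j where "card (layer S v i) \<le> 2 * r * card {x \<in> layer S v i. c x = j}"
    using exists_large_colour_class[of "layer S v i" c "2 * r"] c(1) by blast
  moreover have "indep {x \<in> layer S v i. c x = j}"
    unfolding indep_def using c(2) by (metis (mono_tags, lifting) mem_Collect_eq)
  ultimately show ?thesis by (intro exI[of _ "{x \<in> layer S v i. c x = j}"]) simp
qed

lemma layer_one: "v \<in> S \<Longrightarrow> layer S v 1 = nbrs S v"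
  using irrefl by (auto simp: nbrs_def intro: sym)

text \<open>Let \<open>i >= 1\<close> be the first index for which layer \<open>i + 1\<close> is at
  most \<open>K\<close> times as large as layer \<open>i\<close>. \<open>R\<close> is the ball of
  radius \<open>i + 1\<close>, and \<open>I\<close> is a \<open>1 / (2 * r)\<close> fraction of
  layer \<open>i\<close>. Earlier layers are no larger than layer \<open>i\<close>, so
  \<open>R\<close> is at most \<open>(r + 2) * K\<close> times as large.\<close>

lemma indep_with_few_neighbours:
  fixes K :: real
  assumes A: "finite A" "cycle_free (2 * r + 1) A" and r: "0 < r" and K: "1 \<le> K"
    and v: "v \<in> A" "card A < card (nbrs A v) * K ^ r"
  shows "\<exists>I R. v \<in> R \<and> I \<subseteq> R \<and> R \<subseteq> A \<and> indep I \<and> (\<forall>x\<in>I. nbrs A x \<subseteq> R) \<and>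
    card R \<le> real (2 * r * (r + 2)) * K * card I"
proof -
  define a where "a j = real (card (layer A v j))" for j
  have layer_A: "layer A v j \<subseteq> A" for j
    using ball_subset[OF v(1)] layer_subset_ball by blast
  have a_A: "a j \<le> card A" for j
    unfolding a_def using A(1) layer_A by (simp add: card_mono)
  have a1: "a 1 = card (nbrs A v)"
    using layer_one[OF v(1)] by (simp add: a_def del: layer.simps One_nat_def)
  have "0 < card (nbrs A v)"
    using v(2) by (intro gr0I) auto
  then have a1_ge: "1 \<le> a 1" using a1 by simp
  \<comment> \<open>Otherwise the layers would grow by a factor \<open>K\<close> in each of
    \<open>r\<close> steps, and layer \<open>r + 1\<close> would be larger than
    \<open>A\<close>.\<close>
  have "\<exists>i. 1 \<le> i \<and> i \<le> r \<and> a (Suc i) \<le> K * a i"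
  proof (rule ccontr)
    assume "\<not> ?thesis"
    then have grow: "K * a i \<le> a (Suc i)" if "1 \<le> i" "i \<le> r" for i
      using that by (meson linear)
    have "K ^ j * a 1 \<le> a (Suc j)" if "j \<le> r" for j
      using that
    proof (induction j)
      case (Suc j)
      then have "K * (K ^ j * a 1) \<le> K * a (Suc j)"
        using K by (intro mult_left_mono) auto
      also have "\<dots> \<le> a (Suc (Suc j))" using grow Suc.prems by simp
      finally show ?case by (simp add: mult.assoc)
    qed simp
    from this[of r] a_A[of "Suc r"] v(2) a1 show False by (simp add: mult.commute)
  qed
  then have ex: "\<exists>i. 1 \<le> i \<and> a (Suc i) \<le> K * a i" "\<exists>i. i \<le> r \<and> 1 \<le> i \<and> a (Suc i) \<le> K * a i" by blast+
  define i where "i = (LEAST i. 1 \<le> i \<and> a (Suc i) \<le> K * a i)"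
  have i: "1 \<le> i" "a (Suc i) \<le> K * a i"
    using LeastI_ex[OF ex(1)] unfolding i_def by blast+
  have "i \<le> r"
    using ex(2) Least_le[of "\<lambda>i. 1 \<le> i \<and> a (Suc i) \<le> K * a i"] unfolding i_def by (meson order_trans)
  have before: "a j \<le> a (Suc j)" if "j < i" for j
  proof (cases "j = 0")
    case True
    then show ?thesis using a1_ge by (simp add: a_def)
  next
    case False
    then have "\<not> a (Suc j) \<le> K * a j"
      using not_less_Least[of j "\<lambda>i. 1 \<le> i \<and> a (Suc i) \<le> K * a i"] that by (auto simp: i_def)
    moreover have "a j \<le> K * a j" using K by (simp add: a_def mult_le_cancel_right1)
    ultimately show ?thesis by linarith
  qed
  have a_le: "a (i - s) \<le> a i" if "s \<le> i" for s
    using that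
  proof (induction s)
    case (Suc s)
    then have "Suc (i - Suc s) = i - s" by simp
    then show ?case using before[of "i - Suc s"] Suc by simp
  qed simp
  have card_ball_Suc: "real (card (ball A v (Suc j))) \<le> card (ball A v j) + a (Suc j)" for j
  proof -
    have "card (ball A v (Suc j)) = card (ball A v j \<union> layer A v (Suc j))"
      using ball_mono[of j "Suc j" A v] by (intro arg_cong[where f = card]) auto
    also have "\<dots> \<le> card (ball A v j) + card (layer A v (Suc j))" by (rule card_Un_le)
    finally show ?thesis by (simp add: a_def del: ball.simps layer.simps)
  qed
  have card_ball: "real (card (ball A v j)) \<le> (j + 1) * a i" if "j \<le> i" for j
    using that
  proof (induction j)
    case 0
    then show ?case using a_le[of i] by (simp add: a_def)
  next
    case (Suc j)
    then show ?case
      using card_ball_Suc[of j] a_le[of "i - Suc j"] by (simp add: algebra_simps del: ball.simps)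
  qed
  obtain I where I: "I \<subseteq> layer A v i" "indep I" "card (layer A v i) \<le> 2 * r * card I"
    using layer_large_indep[OF A(1) v(1) A(2) r \<open>i \<le> r\<close>] by blast
  define R where "R = ball A v (Suc i)"
  have I_ball: "I \<subseteq> ball A v i" using I(1) layer_subset_ball by blast
  have a_I: "a i \<le> real (2 * r) * card I"
    using I(3) unfolding a_def by (metis of_nat_le_iff of_nat_mult)
  have "real (card R) \<le> (real i + 1) * a i + K * a i"
    using card_ball_Suc[of i] card_ball[of i] i(2) unfolding R_def by simp
  also have "\<dots> \<le> (real r + 1) * K * a i + K * a i"
    using \<open>i \<le> r\<close> K mult_mono[of "real i + 1" "real r + 1" 1 K]
    by (intro add_mono mult_right_mono) (auto simp: a_def)
  also have "\<dots> = (real r + 2) * K * a i"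
    by (simp add: algebra_simps)
  also have "\<dots> \<le> (real r + 2) * K * (real (2 * r) * card I)"
    using a_I K by (intro mult_left_mono) auto
  also have "\<dots> = real (2 * r * (r + 2)) * K * card I"
    by (simp add: algebra_simps)
  finally have "real (card R) \<le> real (2 * r * (r + 2)) * K * card I" .
  moreover have "v \<in> R"
    using ball_mono[of 0 "Suc i" A v] by (auto simp: R_def)
  moreover have "nbrs A x \<subseteq> R" if "x \<in> I" for x
    using that I_ball by (auto simp: R_def nbrs_def intro: sym)
  moreover have "I \<subseteq> R" "R \<subseteq> A"
    using I_ball ball_subset[OF v(1), of "Suc i"] by (auto simp: R_def)
  ultimately show ?thesis using I(2) by blast
qed

text \<open>Sets \<open>R\<close> as above are removed while some degree is too large. All
  neighbours of \<open>I\<close> lie in \<open>R\<close> and the later set \<open>J\<close> avoids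
  \<open>R\<close>, so the union stays independent and the size bounds add up. A fixed
  \<open>m\<close> keeps the degree threshold constant as \<open>A\<close> shrinks.\<close>

lemma indep_and_sparse:
  fixes K m :: real
  assumes "finite A" "cycle_free (2 * r + 1) A" and r: "0 < r" and K: "1 \<le> K"
    and "card A \<le> m"
  shows "\<exists>I H. I \<subseteq> A \<and> H \<subseteq> A \<and> indep I \<and> card (A - H) \<le> real (2 * r * (r + 2)) * K * card I \<and>
    (\<forall>x\<in>H. card (nbrs H x) * K ^ r \<le> m)"
  using assms(1,2,5)
proof (induction A rule: finite_psubset_induct)
  case (psubset A)
  let ?C = "real (2 * r * (r + 2)) * K"
  show ?case
  proof (cases "\<forall>x\<in>A. card (nbrs A x) * K ^ r \<le> m")
    case True
    then show ?thesis by (intro exI[of _ "{}"] exI[of _ A]) (auto simp: indep_def)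
  next
    case False
    then obtain v where v: "v \<in> A" "m < card (nbrs A v) * K ^ r" by force
    then have "card A < card (nbrs A v) * K ^ r" using psubset.prems by linarith
    then obtain I R where IR: "v \<in> R" "I \<subseteq> R" "R \<subseteq> A" "indep I" "\<forall>x\<in>I. nbrs A x \<subseteq> R"
      "card R \<le> ?C * card I"
      using indep_with_few_neighbours[OF psubset.hyps(1) psubset.prems(1) r K v(1)] by blast
    have fin: "finite R" "finite I" using IR psubset.hyps finite_subset by metis+
    have small: "card (A - R) \<le> m"
      using psubset.prems(2) card_mono[OF psubset.hyps(1), of "A - R"] by fastforce
    have "A - R \<subset> A" using IR v by blast
    moreover have "cycle_free (2 * r + 1) (A - R)"
      using psubset.prems(1) by (rule cycle_free_subset) auto
    ultimately have "\<exists>J H. J \<subseteq> A - R \<and> H \<subseteq> A - R \<and> indep J \<and>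
        card (A - R - H) \<le> ?C * card J \<and> (\<forall>x\<in>H. card (nbrs H x) * K ^ r \<le> m)"
      using small by (rule psubset.IH)
    then obtain J H where JH: "J \<subseteq> A - R" "H \<subseteq> A - R" "indep J"
      "card (A - R - H) \<le> ?C * card J" "\<forall>x\<in>H. card (nbrs H x) * K ^ r \<le> m"
      by blast
    have "finite J" using JH(1) psubset.hyps by (metis finite_Diff finite_subset)
    have "A - H \<subseteq> R \<union> (A - R - H)" by blast
    then have "card (A - H) \<le> card (R \<union> (A - R - H))"
      using psubset.hyps fin by (intro card_mono) auto
    also have "\<dots> \<le> card R + card (A - R - H)" by (rule card_Un_le)
    finally have "real (card (A - H)) \<le> ?C * card I + ?C * card J"
      using IR(6) JH(4) by linarith
    also have "\<dots> = ?C * card (I \<union> J)"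
      using IR(2) JH(1) fin \<open>finite J\<close>
      by (subst card_Un_disjoint) (auto simp: algebra_simps)
    finally have "real (card (A - H)) \<le> ?C * card (I \<union> J)" .
    moreover have "indep (I \<union> J)"
      unfolding indep_def
    proof (intro ballI)
      fix x y assume xy: "x \<in> I \<union> J" "y \<in> I \<union> J"
      have IJ: "\<not> E x y" if "x \<in> I" "y \<in> J" for x y
        using that IR(5) JH(1) by (auto simp: nbrs_def)
      show "\<not> E x y"
        using xy IJ[of x y] IJ[of y x] sym[of x y] IR(4) JH(3) by (auto simp: indep_def)
    qed
    moreover have "I \<union> J \<subseteq> A" "H \<subseteq> A" using IR(2,3) JH(1,2) by auto
    ultimately show ?thesis using JH(5) by blast
  qed
qed

end

section \<open>Colouring graphs without cycles of length \<open>2 * r + 1\<close>\<close>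

definition shrink_const :: "nat \<Rightarrow> real" where
  "shrink_const r = real (2 * r * (r + 2))"

text \<open>Half of this, times \<open>K\<close>, covers the colours of \<open>shrink\<close>: at
  most \<open>shrink_const r * 2 ^ (r + 1) * K + 1\<close> for independent sets and
  \<open>K + 1\<close> for a sparse part. The doubling pays for the geometric series over the halved
  values of \<open>K\<close>.\<close>

definition palette_const :: "nat \<Rightarrow> real" where
  "palette_const r = 2 * (shrink_const r * 2 ^ (r + 1) + 3)"

definition cycle_const :: "nat \<Rightarrow> real" where
  "cycle_const r = 2 * (2 * palette_const r) ^ (r + 1)"

lemma shrink_const_pos: "0 < r \<Longrightarrow> 0 < shrink_const r"
  unfolding shrink_const_def of_nat_0_less_iff by simp

lemma palette_const_ge_1: "1 \<le> palette_const r"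
  by (simp add: palette_const_def shrink_const_def)

lemma cycle_const_ge_1: "1 \<le> cycle_const r"
  using one_le_power[of "2 * palette_const r" "r + 1"] palette_const_ge_1[of r]
  by (simp add: cycle_const_def)

context irreflexive_graph
begin

text \<open>Each round applies \<open>indep_and_sparse\<close>. If \<open>A - H\<close> is small,
  \<open>H\<close> receives the \<open>q\<close> reserved colours and \<open>A - H\<close> is left
  over. Otherwise \<open>I\<close> is large, and it is removed with one new colour.\<close>

lemma shrink_rounds:
  fixes K m \<epsilon> :: real
  assumes r: "0 < r" and K: "1 \<le> K" and q: "0 < q" and m: "0 \<le> m"
    and A: "finite A" "cycle_free (2 * r + 1) A" "card A \<le> m"
  shows "\<exists>A'\<subseteq>A. (card A' \<le> \<epsilon> * m \<or> card A' \<le> card A - t * (\<epsilon> * m / (shrink_const r * K))) \<and>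
    colours (A - A') (t + q) (m\<^sup>2 / (K ^ r * q))"
  using A
proof (induction t arbitrary: A)
  case 0
  have "colours (A - A) (0 + q) (m\<^sup>2 / (K ^ r * q))"
    using K q by (simp add: colours_empty)
  then show ?case by (intro exI[of _ A]) auto
next
  case (Suc t)
  let ?B = "m\<^sup>2 / (K ^ r * q)" and ?s = "\<epsilon> * m / (shrink_const r * K)"
  have B: "0 \<le> ?B" using K by simp
  obtain I H where IH: "I \<subseteq> A" "H \<subseteq> A" "indep I" "card (A - H) \<le> shrink_const r * K * card I"
    "\<forall>x\<in>H. card (nbrs H x) * K ^ r \<le> m"
    using indep_and_sparse[OF Suc.prems(1,2) r K Suc.prems(3)] unfolding shrink_const_def by blast
  have fin: "finite I" "finite H" using IH Suc.prems(1) finite_subset by metis+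
  show ?case
  proof (cases "card (A - H) \<le> \<epsilon> * m")
    case True
    have degree: "real (card (nbrs H x)) \<le> m / K ^ r" if "x \<in> H" for x
      using IH(5) that K by (simp add: pos_le_divide_eq)
    have "colours H q (card H * (m / K ^ r) / q)"
      using colours_degree[OF fin(2) q degree] .
    moreover have "card H * (m / K ^ r) / q \<le> m * (m / K ^ r) / q"
      using card_mono[OF Suc.prems(1) IH(2)] Suc.prems(3) m K
      by (intro divide_right_mono mult_right_mono) auto
    ultimately have "colours H (Suc t + q) ?B"
      by (elim colours_mono) (auto simp: power2_eq_square)
    moreover have "A - (A - H) = H" using IH(2) by blast
    ultimately show ?thesis using True by (intro exI[of _ "A - H"]) auto
  next
    case False
    then have "\<epsilon> * m \<le> shrink_const r * K * card I" using IH(4) by linarith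
    then have I_large: "?s \<le> card I"
      using K shrink_const_pos[OF r] by (simp add: pos_divide_le_eq mult.commute)
    have "card (A - I) = card A - card I" "card I \<le> card A"
      using IH(1) fin Suc.prems(1) by (auto simp: card_Diff_subset card_mono)
    then have card_AI: "real (card (A - I)) = real (card A) - card I" by simp
    have "finite (A - I)" "cycle_free (2 * r + 1) (A - I)" "card (A - I) \<le> m"
      using Suc.prems card_AI cycle_free_subset[of "2 * r + 1" A "A - I"] by auto
    from Suc.IH[OF this] obtain A' where A': "A' \<subseteq> A - I"
      "card A' \<le> \<epsilon> * m \<or> card A' \<le> card (A - I) - t * ?s"
      "colours (A - I - A') (t + q) ?B" by blast
    have "colours ((A - I - A') \<union> I) (t + q + 1) (?B + 0)"
      using Suc.prems(1) fin A'(3) IH(3) by (intro colours_union colours_indep) auto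
    moreover have "(A - I - A') \<union> I = A - A'" using A'(1) IH(1) by blast
    ultimately have "colours (A - A') (Suc t + q) ?B" by simp
    moreover have "card A' \<le> \<epsilon> * m \<or> card A' \<le> card A - Suc t * ?s"
    proof -
      have "Suc t * ?s = t * ?s + ?s" by (simp add: distrib_right add_divide_distrib)
      then show ?thesis using A'(2) I_large card_AI by linarith
    qed
    ultimately show ?thesis using A'(1) by (intro exI[of _ A']) auto
  qed
qed

text \<open>The number \<open>t\<close> is so large that \<open>t\<close> full rounds would remove
  at least \<open>m\<close> vertices, so the remainder is small in either alternative. The choice
  \<open>q >= K\<close> supplies the last factor \<open>K\<close> in the cost.\<close>

lemma shrink:
  fixes K m :: real
  assumes r: "0 < r" and K: "1 \<le> K" and A: "finite A" "cycle_free (2 * r + 1) A" "card A \<le> m"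
  shows "\<exists>A'\<subseteq>A. card A' \<le> m / 2 ^ (r + 1) \<and>
    (\<exists>N. real N \<le> palette_const r / 2 * K \<and> colours (A - A') N (m\<^sup>2 / K ^ (r + 1)))"
proof -
  define C where "C = shrink_const r"
  have C: "0 < C" using shrink_const_pos[OF r] by (simp add: C_def)
  define \<epsilon> :: real where "\<epsilon> = 1 / 2 ^ (r + 1)"
  have \<epsilon>: "0 < \<epsilon>" by (simp add: \<epsilon>_def)
  have m: "0 \<le> m" using A(3) by linarith
  define t where "t = nat \<lceil>C * K / \<epsilon>\<rceil>"
  define q where "q = nat \<lceil>K\<rceil>"
  have t: "C * K / \<epsilon> \<le> t" "t \<le> C * K / \<epsilon> + 1"
    using C K \<epsilon> unfolding t_def by (auto simp: of_nat_nat)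
  have q: "K \<le> q" "q \<le> K + 1" "0 < q"
    using K unfolding q_def by (auto simp: of_nat_nat)
  obtain A' where A': "A' \<subseteq> A"
    "card A' \<le> \<epsilon> * m \<or> card A' \<le> card A - t * (\<epsilon> * m / (C * K))"
    "colours (A - A') (t + q) (m\<^sup>2 / (K ^ r * q))"
    using shrink_rounds[OF r K q(3) m A, of \<epsilon> t] unfolding C_def by blast
  have "m = C * K / \<epsilon> * (\<epsilon> * m / (C * K))"
    using C K \<epsilon> by simp
  also have "\<dots> \<le> t * (\<epsilon> * m / (C * K))"
    using t(1) C K \<epsilon> m by (intro mult_right_mono) auto
  finally have "card A - t * (\<epsilon> * m / (C * K)) \<le> \<epsilon> * m"
    using A(3) mult_nonneg_nonneg[of \<epsilon> m] \<epsilon> m by linarith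
  then have "card A' \<le> \<epsilon> * m"
    using A'(2) by linarith
  moreover have "real (t + q) \<le> palette_const r / 2 * K"
    using t(2) q(2) K by (simp add: palette_const_def C_def \<epsilon>_def algebra_simps)
  moreover have "m\<^sup>2 / (K ^ r * q) \<le> m\<^sup>2 / K ^ (r + 1)"
    using q(1) K by (intro divide_left_mono) auto
  then have "colours (A - A') (t + q) (m\<^sup>2 / K ^ (r + 1))"
    using A'(3) by (elim colours_mono) auto
  ultimately show ?thesis using A'(1) unfolding \<epsilon>_def
    by (intro exI[of _ A'] exI[of _ "t + q"] conjI) simp_all
qed

text \<open>Halving \<open>K\<close> while dividing the number of vertices by \<open>2 ^ (r + 1)\<close> makes both the number of
  colours and the cost \<open>m\<^sup>2 / K ^ (r + 1)\<close> decrease geometrically.\<close>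

lemma cycle_free_colours_aux:
  fixes K m :: real
  assumes r: "0 < r" and "0 < K" "K < 2 ^ n"
    and "finite A" "cycle_free (2 * r + 1) A" "card A \<le> m"
  shows "\<exists>N. real N \<le> palette_const r * K + 1 \<and> colours A N (2 * m\<^sup>2 / K ^ (r + 1))"
  using assms(2-)
proof (induction n arbitrary: A K m)
  \<comment> \<open>For \<open>K <= 1\<close> the allowed cost exceeds \<open>m\<^sup>2\<close>; the
    summand 1 in the palette bound provides the single colour.\<close>
  have one_colour: "\<exists>N. real N \<le> palette_const r * K + 1 \<and> colours A N (2 * m\<^sup>2 / K ^ (r + 1))"
    if "0 < K" "K \<le> 1" "finite A" "card A \<le> m" for K m :: real and A
  proof -
    have "K ^ (r + 1) \<le> 1" using that by (intro power_le_one) auto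
    then have "m\<^sup>2 / 1 \<le> m\<^sup>2 / K ^ (r + 1)"
      using that by (intro divide_left_mono) auto
    moreover have "0 \<le> m\<^sup>2 / K ^ (r + 1)" using that by simp
    ultimately have "m\<^sup>2 \<le> 2 * m\<^sup>2 / K ^ (r + 1)" by simp
    moreover have "colours A 1 (m\<^sup>2)"
      using that by (intro colours_trivial) auto
    ultimately have "colours A 1 (2 * m\<^sup>2 / K ^ (r + 1))"
      by (elim colours_mono) auto
    then show ?thesis using that palette_const_ge_1[of r] by (intro exI[of _ 1]) simp
  qed
  {
    case 0
    then show ?case by (intro one_colour) auto
  next
    case (Suc n)
    show ?case
    proof (cases "K < 1")
      case True
      then show ?thesis using Suc.prems by (intro one_colour) auto
    next
      case False
      then have K: "1 \<le> K" by simp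
      obtain A' N where A': "A' \<subseteq> A" "card A' \<le> m / 2 ^ (r + 1)"
        "real N \<le> palette_const r / 2 * K" "colours (A - A') N (m\<^sup>2 / K ^ (r + 1))"
        using shrink[OF r K Suc.prems(3-5)] by blast
      have fin: "finite A'" using A'(1) Suc.prems(3) by (rule finite_subset)
      obtain N' where N': "real N' \<le> palette_const r * (K / 2) + 1"
        "colours A' N' (2 * (m / 2 ^ (r + 1))\<^sup>2 / (K / 2) ^ (r + 1))"
        using Suc.IH[of "K / 2" A' "m / 2 ^ (r + 1)"] K Suc.prems A' fin cycle_free_subset by auto
      \<comment> \<open>The smaller set gains a factor \<open>4 ^ (r + 1)\<close> and the halved
        \<open>K\<close> loses \<open>2 ^ (r + 1)\<close>.\<close>
      have "2 * (m / 2 ^ (r + 1))\<^sup>2 / (K / 2) ^ (r + 1) = m\<^sup>2 / K ^ (r + 1) / 2 ^ r"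
        using K by (simp add: power_divide power2_eq_square field_simps)
      also have "\<dots> \<le> m\<^sup>2 / K ^ (r + 1) / 1"
        using K by (intro divide_left_mono) auto
      finally have cost: "2 * (m / 2 ^ (r + 1))\<^sup>2 / (K / 2) ^ (r + 1) \<le> m\<^sup>2 / K ^ (r + 1)" by simp
      have "colours A (N + N') (m\<^sup>2 / K ^ (r + 1) + 2 * (m / 2 ^ (r + 1))\<^sup>2 / (K / 2) ^ (r + 1))"
        using Suc.prems(3) A' N'(2) by (intro colours_split)
      then have "colours A (N + N') (2 * m\<^sup>2 / K ^ (r + 1))"
        using cost by (elim colours_mono) auto
      then show ?thesis using A'(3) N'(1) by (intro exI[of _ "N + N'"]) simp
    qed
  }
qed

lemma cycle_free_colours:
  fixes m :: real
  assumes r: "0 < r" and k: "0 < k" and A: "finite A" "cycle_free (2 * r + 1) A" "card A \<le> m"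
  shows "colours A k (cycle_const r * m\<^sup>2 / real k ^ (r + 1))"
proof (cases "k = 1")
  case True
  have "colours A 1 (m\<^sup>2)" using A by (intro colours_trivial) auto
  moreover have "1 * m\<^sup>2 \<le> cycle_const r * m\<^sup>2"
    using cycle_const_ge_1 by (intro mult_right_mono) auto
  ultimately show ?thesis using True by (auto elim: colours_mono)
next
  case False
  \<comment> \<open>Now \<open>palette_const r * K + 1\<close> is \<open>k / 2 + 1\<close>, which is
    at most \<open>k\<close> only for \<open>k >= 2\<close>; hence the separate case
    \<open>k = 1\<close>.\<close>
  define K where "K = k / (2 * palette_const r)"
  have P: "0 < palette_const r" using palette_const_ge_1[of r] by linarith
  have K: "0 < K" using P k by (simp add: K_def)
  obtain n where "K < 2 ^ n" using real_arch_pow[of 2 K] by auto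
  then obtain N where N: "real N \<le> palette_const r * K + 1" "colours A N (2 * m\<^sup>2 / K ^ (r + 1))"
    using cycle_free_colours_aux[OF r K _ A] by blast
  have "palette_const r * K = k / 2" using P by (simp add: K_def)
  then have "N \<le> k" using N(1) False k by linarith
  moreover have "2 * m\<^sup>2 / K ^ (r + 1) = cycle_const r * m\<^sup>2 / real k ^ (r + 1)"
    using P k by (simp add: K_def cycle_const_def power_divide)
  ultimately show ?thesis using N(2) by (auto elim: colours_mono)
qed

section \<open>Graphs with cycle-free neighbourhoods\<close>

text \<open>While some degree exceeds \<open>D\<close>, a part \<open>S\<close> of that
  neighbourhood is cut off and given \<open>t\<close> fresh colours. It has at least
  \<open>D\<close> vertices, which bounds the number \<open>j\<close> of parts, and at most
  \<open>2 * D\<close>, which bounds its cost.\<close>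

lemma peel_neighbourhoods:
  fixes D :: real
  assumes r: "0 < r" and t: "0 < t" and D: "1 \<le> D"
    and "finite A" "\<forall>x\<in>A. cycle_free (2 * r + 1) (nbrs A x)"
  shows "\<exists>H\<subseteq>A. \<exists>j. j * D \<le> card A \<and> (\<forall>x\<in>H. card (nbrs H x) \<le> D) \<and>
    colours (A - H) (j * t) (j * (cycle_const r * (2 * D)\<^sup>2 / real t ^ (r + 1)))"
  using assms(4,5)
proof (induction A rule: finite_psubset_induct)
  case (psubset A)
  let ?B = "cycle_const r * (2 * D)\<^sup>2 / real t ^ (r + 1)"
  show ?case
  proof (cases "\<forall>x\<in>A. card (nbrs A x) \<le> D")
    case True
    have "colours (A - A) (0 * t) (0 * ?B)" by (simp add: colours_empty)
    then show ?thesis using True by (intro exI[of _ A] exI[of _ 0] conjI) auto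
  next
    case False
    then obtain v where v: "v \<in> A" "D < card (nbrs A v)" by force
    define s where "s = nat \<lceil>D\<rceil>"
    have s: "D \<le> s" "s \<le> 2 * D" using D unfolding s_def by (auto simp: of_nat_nat) linarith+
    have "s \<le> card (nbrs A v)" using v(2) unfolding s_def by (simp add: ceiling_le_iff nat_le_iff)
    then obtain S where S: "S \<subseteq> nbrs A v" "card S = s" "finite S"
      by (rule obtain_subset_with_card_n)
    have SA: "S \<subseteq> A" using S(1) by (auto simp: nbrs_def)
    have "S \<noteq> {}" using S(2) s D by auto
    then have "A - S \<subset> A" using SA by blast
    moreover have "\<forall>x\<in>A - S. cycle_free (2 * r + 1) (nbrs (A - S) x)"
      using psubset.prems cycle_free_subset[of "2 * r + 1" "nbrs A x" "nbrs (A - S) x" for x]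
      by (auto simp: nbrs_def)
    ultimately have "\<exists>H\<subseteq>A - S. \<exists>j. j * D \<le> card (A - S) \<and> (\<forall>x\<in>H. card (nbrs H x) \<le> D) \<and>
        colours (A - S - H) (j * t) (j * ?B)"
      by (rule psubset.IH)
    then obtain H j where H: "H \<subseteq> A - S" "j * D \<le> card (A - S)" "\<forall>x\<in>H. card (nbrs H x) \<le> D"
      "colours (A - S - H) (j * t) (j * ?B)" by blast
    have "cycle_free (2 * r + 1) S"
      using psubset.prems v(1) S(1) cycle_free_subset by blast
    then have "colours S t ?B"
      using s(2) S by (intro cycle_free_colours r t) auto
    then have "colours ((A - S - H) \<union> S) (j * t + t) (j * ?B + ?B)"
      using psubset.hyps(1) S(3) H(4) by (intro colours_union) auto
    moreover have "(A - S - H) \<union> S = A - H" using H(1) SA by blast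
    moreover have "real (Suc j) * b = real j * b + b" for b :: real
      by (simp add: distrib_right)
    ultimately have "colours (A - H) (Suc j * t) (Suc j * ?B)"
      by (simp only: mult_Suc add.commute[of t])
    moreover have "card (A - S) + card S = card A"
      using SA S(3) psubset.hyps(1) by (simp add: card_Diff_subset card_mono)
    then have "Suc j * D \<le> card A"
      using H(2) s(1) S(2) by (simp add: distrib_right)
    ultimately show ?thesis
      using H(1,3) by (intro exI[of _ H] exI[of _ "Suc j"] conjI) auto
  qed
qed

lemma locally_cycle_free_colours:
  fixes k :: nat and x :: real
  assumes r: "0 < r" and k: "2 \<le> k" and V: "finite V" "k \<le> card V"
    and cf: "\<forall>v\<in>V. cycle_free (2 * r + 1) (nbrs V v)"
    and x: "1 \<le> x" "x ^ (r + 1) = k"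
  shows "colours V k (4 ^ (r + 2) * (cycle_const r + 1) * ((card V)\<^sup>2 * x / k\<^sup>2))"
proof -
  define n where "n = real (card V)"
  define C where "C = cycle_const r"
  have C: "1 \<le> C" using cycle_const_ge_1 by (simp add: C_def)
  have n: "real k \<le> n" "0 < n" using V k by (auto simp: n_def)
  define T where "T = n\<^sup>2 * x / k\<^sup>2"
  have T: "0 \<le> T" using x by (simp add: T_def)
  have pow: "(4::real) ^ (r + 2) = 4 * 4 ^ (r + 1)" by simp
  have "colours V k (4 ^ (r + 2) * (C + 1) * T)"
  proof (cases "x < 2")
    \<comment> \<open>Here \<open>k\<close> is at most \<open>2 ^ (r + 1)\<close>, so the trivial
      cost is within a constant of the target. The other case needs \<open>x >= 2\<close> to get
      \<open>t > 0\<close>.\<close>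
    case True
    then have "x ^ (r + 1) \<le> 2 ^ (r + 1)" using x by (intro power_mono) auto
    then have "real k \<le> 2 ^ (r + 1)" using x by simp
    then have "(real k)\<^sup>2 \<le> (2 ^ (r + 1))\<^sup>2" by (intro power_mono) auto
    also have "\<dots> = 4 ^ (r + 1)" by (simp add: power_mult[symmetric] power_even_eq power2_eq_square flip: power_mult_distrib)
    finally have "n\<^sup>2 * (real k)\<^sup>2 \<le> n\<^sup>2 * (4 ^ (r + 1) * x)"
      using x mult_mono[of "(real k)\<^sup>2" "4 ^ (r + 1)" 1 x] by (intro mult_left_mono) auto
    then have "n\<^sup>2 \<le> 4 ^ (r + 1) * T"
      using k by (simp add: T_def field_simps)
    also have "\<dots> \<le> 4 ^ (r + 2) * (C + 1) * T"
      using C T pow by (intro mult_right_mono) auto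
    finally show ?thesis
      using colours_trivial[of V k n] V k by (auto simp: n_def elim: colours_mono)
  next
    case False
    define D where "D = n * x / k"
    have D: "1 \<le> D"
      using mult_mono[of "real k" n 1 x] n x k by (simp add: D_def)
    \<comment> \<open>With half of \<open>x\<close> per part, at most \<open>k / x\<close> parts use
      at most \<open>k / 2\<close> colours. As \<open>x / 2 >= 1\<close>, rounding down keeps
      \<open>t >= x / 4\<close>.\<close>
    define t where "t = nat \<lfloor>x / 2\<rfloor>"
    have "real t \<le> x / 2" "x / 2 < real t + 1" "0 < t"
      using False unfolding t_def by (auto simp: of_nat_nat) linarith+
    then have t: "real t \<le> x / 2" "x / 4 \<le> t" "0 < t"
      by (simp, linarith, simp)
    obtain H j where H: "H \<subseteq> V" "j * D \<le> n" "\<forall>x\<in>H. card (nbrs H x) \<le> D"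
      "colours (V - H) (j * t) (j * (C * (2 * D)\<^sup>2 / real t ^ (r + 1)))"
      using peel_neighbourhoods[OF r t(3) D V(1) cf] unfolding C_def n_def by blast
    have jx: "j * x \<le> k"
      using H(2) n k by (simp add: D_def field_simps)
    have "real j * t \<le> j * (x / 2)" using t(1) by (intro mult_left_mono) auto
    also have "\<dots> \<le> k / 2" using jx by simp
    finally have jt: "real (j * t) \<le> k / 2" by simp
    define q where "q = k - j * t"
    have "real q = k - real (j * t)"
      using jt unfolding q_def by (subst of_nat_diff) linarith+
    then have q: "k / 2 \<le> real q" "0 < q" "j * t + q = k"
      using jt k unfolding q_def by linarith+
    have fin: "finite H" using H(1) V(1) by (rule finite_subset)
    have "card H \<le> n" using card_mono[OF V(1) H(1)] by (simp add: n_def)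
    then have "card H * D / q \<le> n * D / (k / 2)"
      using q k D n by (intro frac_le mult_right_mono) auto
    also have "\<dots> = 2 * T" by (simp add: D_def T_def power2_eq_square)
    finally have cost_H: "card H * D / q \<le> 2 * T" .
    have "k / 4 ^ (r + 1) = (x / 4) ^ (r + 1)" using x by (simp add: power_divide)
    also have "\<dots> \<le> real t ^ (r + 1)" using t x by (intro power_mono) auto
    finally have t_pow: "k / 4 ^ (r + 1) \<le> real t ^ (r + 1)" .
    \<comment> \<open>The factor \<open>4 ^ (r + 2)\<close> combines \<open>4 ^ (r + 1)\<close> from
      \<open>t >= x / 4\<close> with 4 from squaring \<open>2 * D\<close>.\<close>
    have "j * (C * (2 * D)\<^sup>2 / real t ^ (r + 1)) \<le> (k / x) * (C * (2 * D)\<^sup>2 / (k / 4 ^ (r + 1)))"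
      using t_pow jx x C k t(3) by (intro mult_mono divide_left_mono) (auto simp: field_simps)
    also have "\<dots> = 4 ^ (r + 2) * C * T"
      using x k unfolding D_def T_def by (simp add: field_simps power2_eq_square)
    finally have cost_peel: "j * (C * (2 * D)\<^sup>2 / real t ^ (r + 1)) \<le> 4 ^ (r + 2) * C * T" .
    have "colours H q (card H * D / q)"
      using H(3) fin q(2) by (intro colours_degree) auto
    then have "colours V (j * t + q) (j * (C * (2 * D)\<^sup>2 / real t ^ (r + 1)) + card H * D / q)"
      using V(1) H(1,4) by (intro colours_split)
    \<comment> \<open>The summand 1 in \<open>C + 1\<close> absorbs the cost of
      \<open>H\<close>.\<close>
    moreover have "2 * T \<le> 4 ^ (r + 2) * T"
      using T one_le_power[of "4::real" "r + 1"] by (intro mult_right_mono) (auto simp: pow)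
    ultimately show ?thesis
      using cost_H cost_peel q(3) by (elim colours_mono) (auto simp: algebra_simps)
  qed
  then show ?thesis by (simp add: T_def n_def C_def)
qed

end

section \<open>From colourings back to wheel-free graphs\<close>

text \<open>Deleting the monochromatic edges makes the colouring proper, and there are no more such
  edges than ordered pairs.\<close>

lemma h_graph_le:
  fixes G :: "'a graph" and B :: real
  assumes G: "simple_graph G" and "0 < k"
    and "irreflexive_graph.colours (\<lambda>x y. {x, y} \<in> edges G) (verts G) k B"
  shows "h_graph G k \<le> B"
proof -
  let ?E = "\<lambda>x y. {x, y} \<in> edges G"
  interpret irreflexive_graph ?E
  proof
    show "{y, x} \<in> edges G" if "{x, y} \<in> edges G" for x y
      using that by (simp add: insert_commute)
    show "{x, x} \<notin> edges G" for x
      using G by (auto simp: simple_graph_def)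
  qed
  obtain c where c: "\<forall>x\<in>verts G. c x < k" "card (mono_pairs (verts G) c) \<le> B"
    using assms(3) unfolding colours_def by blast
  define F where "F = (\<lambda>(x, y). {x, y}) ` mono_pairs (verts G) c"
  have fin: "finite (mono_pairs (verts G) c)"
    using G by (intro finite_mono_pairs) (simp add: simple_graph_def)
  have ends: "x \<in> verts G \<and> y \<in> verts G" if "{x, y} \<in> edges G" for x y
    using that G by (auto simp: simple_graph_def)
  have "F \<subseteq> edges G" by (auto simp: F_def mono_pairs_def)
  moreover have "colorable k (verts G, edges G - F)"
    unfolding colorable_def
  proof (intro exI[of _ c] conjI allI impI)
    show "c ` verts (verts G, edges G - F) \<subseteq> {..<k}" using c(1) by auto
    fix x y assume xy: "{x, y} \<in> edges (verts G, edges G - F)"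
    show "c x \<noteq> c y"
    proof
      assume "c x = c y"
      then have "(x, y) \<in> mono_pairs (verts G) c"
        using xy ends by (auto simp: mono_pairs_def)
      then have "{x, y} \<in> F" unfolding F_def by force
      then show False using xy by simp
    qed
  qed
  ultimately have "h_graph G k \<le> card F"
    unfolding h_graph_def using h_graph_set(1)[OF G] \<open>0 < k\<close> by (intro Min_le) auto
  also have "card F \<le> card (mono_pairs (verts G) c)"
    unfolding F_def using fin by (rule card_image_le)
  finally show ?thesis using c(2) by linarith
qed

text \<open>A cycle among the neighbours of \<open>v\<close>, with \<open>v\<close> as the hub, is a
  copy of the wheel.\<close>

lemma wheel_free_neighbourhood:
  assumes G: "simple_graph G" and free: "is_free (wheel l) G" and v: "v \<in> verts G"
    and "irreflexive_graph (\<lambda>x y. {x, y} \<in> edges G)"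
  shows "irreflexive_graph.cycle_free (\<lambda>x y. {x, y} \<in> edges G) l
    (irreflexive_graph.nbrs (\<lambda>x y. {x, y} \<in> edges G) (verts G) v)"
proof -
  interpret irreflexive_graph "\<lambda>x y. {x, y} \<in> edges G" by fact
  show ?thesis
    unfolding cycle_free_def
  proof
    assume "\<exists>f. inj_on f {..<l} \<and> f ` {..<l} \<subseteq> nbrs (verts G) v \<and>
      (\<forall>i<l. {f i, f ((i + 1) mod l)} \<in> edges G)"
    then obtain f where f: "inj_on f {..<l}" "f ` {..<l} \<subseteq> nbrs (verts G) v"
      "\<forall>i<l. {f i, f ((i + 1) mod l)} \<in> edges G" by blast
    have nb: "f i \<in> verts G" "{v, f i} \<in> edges G" "f i \<noteq> v" if "i < l" for i
    proof -
      have "f i \<in> nbrs (verts G) v" using f(2) that by blast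
      then show "f i \<in> verts G" "{v, f i} \<in> edges G" "f i \<noteq> v"
        using irrefl[of v] by (auto simp: nbrs_def)
    qed
    define g where "g i = (if i < l then f i else v)" for i
    have "inj_on g {..l}"
    proof (rule linorder_inj_onI')
      fix i j assume "i \<in> {..l}" "j \<in> {..l}" "i < j"
      then show "g i \<noteq> g j"
        using f(1) nb(3)[of i] by (auto simp: g_def inj_on_def)
    qed
    moreover have "g ` {..l} \<subseteq> verts G"
      using nb(1) v by (auto simp: g_def)
    moreover have "g ` e \<in> edges G" if "e \<in> edges (wheel l)" for e
    proof -
      from that consider i where "i < l" "e = {i, (i + 1) mod l}" | i where "i < l" "e = {i, l}"
        unfolding wheel_def by auto
      then show ?thesis
      proof cases
        case 1
        then have "(i + 1) mod l < l" by simp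
        then show ?thesis using 1 f(3) by (simp add: g_def)
      next
        case 2
        then show ?thesis using nb(2) by (simp add: g_def insert_commute)
      qed
    qed
    ultimately have "contains_subgraph G (wheel l)"
      unfolding contains_subgraph_def by (intro exI[of _ g]) (simp add: wheel_def)
    then show False using free by (simp add: is_free_def)
  qed
qed

theorem theorem1p5:
  fixes r :: nat
  assumes "r \<ge> 1"
  shows "\<exists>c :: real. \<forall>n k :: nat. n \<ge> k \<and> k \<ge> 2 \<longrightarrow>
    real (h_free n k (wheel (2 * r + 1))) \<le>
      c * ((real n)\<^sup>2 / real k powr (2 - 1 / (real r + 1)))"
proof (intro exI[of _ "4 ^ (r + 2) * (cycle_const r + 1)"] allI impI)
  fix n k :: nat assume nk: "n \<ge> k \<and> k \<ge> 2"
  let ?W = "wheel (2 * r + 1)"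
  define S where "S = {h_graph G k | G :: nat graph. simple_graph G \<and> card (verts G) = n \<and> is_free ?W G}"
  \<comment> \<open>With this root of \<open>k\<close>, the denominator in the claim is
    \<open>k\<^sup>2 / x\<close>.\<close>
  define x where "x = real k powr (1 / (real r + 1))"
  have "x ^ (r + 1) = real k powr (1 / (real r + 1) * real (r + 1))"
    using nk unfolding x_def by (subst powr_powr [symmetric], subst powr_realpow) auto
  also have "1 / (real r + 1) * real (r + 1) = 1"
    by simp
  finally have x: "1 \<le> x" "x ^ (r + 1) = k"
    using nk by (auto simp: x_def ge_one_powr_ge_zero)
  \<comment> \<open>A wheel with an edge makes the edgeless graph admissible, so \<open>S\<close> is
    nonempty and some \<open>G\<close> attains the maximum.\<close>
  have "edges ?W \<noteq> {}" by (auto simp: wheel_def)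
  then have "finite S" "S \<noteq> {}"
    using h_free_set[of k ?W n] nk unfolding S_def by auto
  then have "Max S \<in> S" by (rule Max_in)
  moreover have "h_free n k ?W = Max S" by (simp add: h_free_def S_def)
  ultimately obtain G :: "nat graph" where G: "h_free n k ?W = h_graph G k" "simple_graph G"
    "card (verts G) = n" "is_free ?W G"
    unfolding S_def by auto
  have E: "irreflexive_graph (\<lambda>x y. {x, y} \<in> edges G)"
    using G(2) by unfold_locales (auto simp: simple_graph_def insert_commute)
  have "irreflexive_graph.colours (\<lambda>x y. {x, y} \<in> edges G) (verts G) k
    (4 ^ (r + 2) * (cycle_const r + 1) * ((card (verts G))\<^sup>2 * x / k\<^sup>2))"
    using assms nk G x wheel_free_neighbourhood[OF G(2,4) _ E]
    by (intro irreflexive_graph.locally_cycle_free_colours[OF E]) (auto simp: simple_graph_def)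
  then have "h_graph G k \<le> 4 ^ (r + 2) * (cycle_const r + 1) * ((card (verts G))\<^sup>2 * x / k\<^sup>2)"
    using h_graph_le[OF G(2)] nk by simp
  moreover have "real k powr (2 - 1 / (real r + 1)) = (real k)\<^sup>2 / x"
  proof -
    have "real k powr 2 = (real k)\<^sup>2" using nk by simp
    then show ?thesis by (simp only: powr_diff x_def)
  qed
  ultimately show "real (h_free n k ?W) \<le> 4 ^ (r + 2) * (cycle_const r + 1) *
      ((real n)\<^sup>2 / real k powr (2 - 1 / (real r + 1)))"
    using G(1,3) by simp
qed

end
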